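(* Let $c, d \in \mathbb{Z}$ with $d \ge 2$, and let $S_{d,c}$ be the set of primes $p$ such that the map induced by $\phi(x) = x^d + c$ on $\mathbb{Z}/p\mathbb{Z}$ consists of a single $p$-cycle. If $d \equiv 3 \pmod 4$ and $p$ is a prime with $p \equiv 1 \pmod 4$, then $p \notin S_{d,c}$.
   Context: For a prime $p$, the polynomial $\phi \in \mathbb{Z}[x]$ induces a map $\phi: \mathbb{Z}/p\mathbb{Z} \to \mathbb{Z}/p\mathbb{Z}$. "Consists of a single $p$-cycle" means that this map is a permutation of the $p$ elements of $\mathbb{Z}/p\mathbb{Z}$ that is a cycle of length $p$ (equivalently, $0$ is periodic with exact period $p$ modulo $p$). *)

theory Defs
  imports
    "HOL-Computational_Algebra.Computational_Algebra"
    "HOL-Number_Theory.Number_Theory"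
    "HOL-Combinatorics.Orbits"
begin

text \<open>
  The ring of integers modulo \<open>m\<close> is the library's \<^const>\<open>residue_ring\<close>, whose carrier is the
  set \<open>{0..m - 1}\<close> of least nonnegative residues. An integer polynomial acts on it by evaluation
  at a representative followed by reduction.
\<close>

definition induced_map :: "int poly \<Rightarrow> nat \<Rightarrow> int \<Rightarrow> int" where
  "induced_map f m a = poly f a mod int m"

lemma poly_cong_int:
  fixes f :: "int poly"
  assumes "[a = b] (mod m)"
  shows "[poly f a = poly f b] (mod m)"
  by (induction f) (auto intro!: cong_add cong_mult assms)

lemma induced_map_well_defined:
  "[a = b] (mod int m) \<Longrightarrow> induced_map f m a = induced_map f m b"
  unfolding induced_map_def using poly_cong_int[of a b "int m" f] by (simp add: cong_def)

lemma induced_map_in_carrier: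
  "m > 0 \<Longrightarrow> induced_map f m a \<in> carrier (residue_ring (int m))"
  by (simp add: induced_map_def residue_ring_def)

text \<open>
  A cycle on a set \<open>S\<close> of \<open>m\<close> points, in the sense of \<^const>\<open>cyclic_on\<close>, is exactly a
  cycle of length \<open>m\<close> moving around all of \<open>S\<close>.
\<close>

definition single_cycle_mod :: "int poly \<Rightarrow> nat \<Rightarrow> bool" where
  "single_cycle_mod f m \<longleftrightarrow>
     bij_betw (induced_map f m) (carrier (residue_ring (int m))) (carrier (residue_ring (int m))) \<and>
     cyclic_on (induced_map f m) (carrier (residue_ring (int m)))"

definition unicritical_poly :: "nat \<Rightarrow> int \<Rightarrow> int poly" where
  "unicritical_poly d c = Polynomial.monom 1 d + [:c:]"

lemma poly_unicritical_poly: "poly (unicritical_poly d c) x = x ^ d + c"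
  by (simp add: unicritical_poly_def poly_monom)

definition single_cycle_primes :: "nat \<Rightarrow> int \<Rightarrow> nat set" where
  "single_cycle_primes d c = {p. prime p \<and> single_cycle_mod (unicritical_poly d c) p}"

end

theory Submission
  imports Defs
begin

text \<open>
  If \<open>f(x) = x\<^sup>d + c\<close> is a \<open>p\<close>-cycle, then \<open>f\<close> and the translation by \<open>c\<close> have trivial \<open>p\<close>-th
  power with \<open>p\<close> odd, so both are even permutations, and hence so is \<open>x \<mapsto> x\<^sup>d\<close>. As \<open>d\<close> is odd,
  the latter commutes with negation; its sign is therefore the parity of the number \<open>k\<close> of
  \<open>x\<close> in the half system \<open>{1..M}\<close>, \<open>M = (p - 1)/2\<close>, with \<open>x\<^sup>d\<close> outside it. As in Gauss's lemma,
  multiplying over the half system gives \<open>M!\<^sup>d \<equiv> (-1)\<^sup>k M!\<close>, that is \<open>M!\<close> to the power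
  \<open>d - 1\<close> is \<open>(-1)\<^sup>k\<close>. Since \<open>p \<equiv> 1 (mod 4)\<close>, Wilson's theorem gives \<open>M!\<^sup>2 \<equiv> -1\<close>, and since
  \<open>(d - 1)/2\<close> is odd, \<open>k\<close> is odd: \<open>x \<mapsto> x\<^sup>d\<close> is an odd permutation, a contradiction.
\<close>

section \<open>Cycles, and the sign of a permutation with a trivial odd power\<close>

text \<open>\<open>S\<close> is the orbit of each of its points, so the first return time is
  \<open>card S\<close>; off \<open>S\<close> the map is the identity.\<close>

lemma funpow_card_cyclic_on:
  assumes "f permutes S" "cyclic_on f S"
  shows "f ^^ card S = id"
proof
  fix x
  show "(f ^^ card S) x = id x"
  proof (cases "x \<in> S")
    case True
    with assms(2) have S: "S = orbit f x"
      by (auto simp: cyclic_on_alldef)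
    with True have self: "x \<in> orbit f x" by simp
    have "card S = funpow_dist1 f x x"
      unfolding S by (subst orbit_conv_funpow_dist1[OF self])
        (simp add: card_image[OF inj_on_funpow_dist1[OF self]])
    with funpow_dist1_prop[OF self] show ?thesis
      by (metis id_apply)
  next
    case False
    hence "(f ^^ n) x = x" for n
      using permutes_not_in[OF assms(1)] by (induction n) auto
    thus ?thesis by simp
  qed
qed

lemma permutation_funpow: "permutation f \<Longrightarrow> permutation (f ^^ n)"
  by (induction n) (auto intro: permutation_compose)

lemma sign_funpow: "permutation f \<Longrightarrow> sign (f ^^ n) = sign f ^ n"
  by (induction n) (auto simp: sign_compose permutation_funpow id_def[symmetric])

lemma sign_eq_1_if_odd_funpow_eq_id:
  assumes "permutation f" "f ^^ n = id" "odd n"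
  shows "sign f = 1"
  using sign_funpow[OF assms(1), of n] assms(2,3)
  by (cases f rule: sign_cases) simp_all

section \<open>Permutations commuting with an involution\<close>

text \<open>\<open>R\<close> holds one point of each pair \<open>x\<close>, \<open>\<nu> x\<close>.
  Induction on the number of points that \<open>\<sigma>\<close> moves out of \<open>R\<close>: with
  none, \<open>\<sigma>\<close> is even, and each such point costs one transposition.\<close>

lemma sign_commuting_involution:
  fixes \<sigma> \<nu> :: "'a \<Rightarrow> 'a"
  assumes "finite R" and invol: "\<And>x. \<nu> (\<nu> x) = x" and "permutation \<nu>"
    and disj: "R \<inter> \<nu> ` R = {}"
    and "\<sigma> permutes (R \<union> \<nu> ` R)" and "\<And>x. \<sigma> (\<nu> x) = \<nu> (\<sigma> x)"
  shows "sign \<sigma> = (-1) ^ card {r \<in> R. \<sigma> r \<notin> R}"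
  using assms(5,6)
proof (induction "card {r \<in> R. \<sigma> r \<notin> R}" arbitrary: \<sigma>)
  case 0
  have stable: "\<sigma> r \<in> R" if "r \<in> R" for r
    using 0(1) that \<open>finite R\<close> by auto
  have inj: "inj \<sigma>" using 0(2) by (rule permutes_inj)
  define \<phi> where "\<phi> = perm_restrict \<sigma> R"
  have "\<sigma> ` R = R"
    using stable \<open>finite R\<close> inj
    by (intro card_subset_eq) (auto intro!: card_image inj_on_subset[of \<sigma> UNIV])
  hence "bij_betw \<phi> R R"
    using inj_on_subset[OF inj, of R]
    by (auto simp: bij_betw_def \<phi>_def perm_restrict_def inj_on_def)
  hence "\<phi> permutes R"
    by (rule bij_imp_permutes) (simp add: \<phi>_def perm_restrict_def)
  hence perm: "permutation \<phi>"
    using \<open>finite R\<close> by (rule permutes_imp_permutation[rotated])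
  \<comment> \<open>\<open>\<sigma>\<close> is \<open>\<phi>\<close> times its conjugate by \<open>\<nu>\<close>, which has the same sign.\<close>
  have "\<sigma> x = (\<phi> \<circ> (\<nu> \<circ> (\<phi> \<circ> \<nu>))) x" for x
  proof -
    consider "x \<in> R" | "\<nu> x \<in> R" | "x \<notin> R \<union> \<nu> ` R"
      using invol by (metis UnE imageE)
    thus ?thesis
    proof cases
      case 1
      hence "\<nu> x \<notin> R" using disj by auto
      with 1 show ?thesis by (simp add: \<phi>_def perm_restrict_def invol)
    next
      case 2
      have "\<nu> (\<sigma> (\<nu> x)) \<notin> R" using stable[OF 2] disj by auto
      with 2 show ?thesis
        using 0(3) by (simp add: \<phi>_def perm_restrict_def invol)
    next
      case 3
      hence "\<nu> x \<notin> R" using invol[of x] by (metis UnCI imageI)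
      with 3 show ?thesis
        using permutes_not_in[OF 0(2)] by (simp add: \<phi>_def perm_restrict_def invol)
    qed
  qed
  hence "\<sigma> = \<phi> \<circ> (\<nu> \<circ> (\<phi> \<circ> \<nu>))" by blast
  hence "sign \<sigma> = sign \<phi> * (sign \<nu> * (sign \<phi> * sign \<nu>))"
    using perm \<open>permutation \<nu>\<close> by (simp add: sign_compose permutation_compose)
  thus ?case by (simp add: 0(1)[symmetric] mult.left_commute)
next
  case (Suc n)
  have inj: "\<sigma> x = \<sigma> y \<longleftrightarrow> x = y" for x y
    using permutes_inj[OF Suc.prems(1)] by (auto dest: injD)
  obtain r where r: "r \<in> R" "\<sigma> r \<notin> R"
    using Suc.hyps(2) by (metis (mono_tags, lifting) Collect_empty_eq card.empty nat.distinct(1))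
  define y where "y = \<sigma> r"
  have y_in: "y \<in> R \<union> \<nu> ` R"
    using r permutes_in_image[OF Suc.prems(1)] by (auto simp: y_def)
  hence \<nu>y: "\<nu> y \<in> R" using r(2) invol by (auto simp: y_def)
  \<comment> \<open>Exchanging \<open>y\<close> with \<open>\<nu> y\<close> keeps commutation with \<open>\<nu>\<close>, flips the sign, and repairs exactly
    the one bad point \<open>r\<close>.\<close>
  define \<tau> where "\<tau> = transpose y (\<nu> y) \<circ> \<sigma>"
  have \<tau>r: "\<tau> r = \<nu> y" by (simp add: \<tau>_def y_def)
  have other: "\<tau> s = \<sigma> s" if "s \<in> R" "s \<noteq> r" for s
  proof -
    \<comment> \<open>If \<open>\<sigma> s = \<nu> y\<close>, commutation would give
      \<open>s = \<nu> r\<close>, which lies outside \<open>R\<close>.\<close>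
    have "s \<noteq> \<nu> r" using that r disj by auto
    hence "\<sigma> s \<noteq> \<nu> y" using Suc.prems(2)[of r] inj[of s "\<nu> r"] by (simp add: y_def)
    moreover have "\<sigma> s \<noteq> y" using that inj by (simp add: y_def)
    ultimately show ?thesis by (simp add: \<tau>_def)
  qed
  have bad: "{s \<in> R. \<sigma> s \<notin> R} = insert r {s \<in> R. \<tau> s \<notin> R}"
    using other r \<tau>r \<nu>y by (auto; metis)
  have card: "card {s \<in> R. \<sigma> s \<notin> R} = Suc (card {s \<in> R. \<tau> s \<notin> R})"
    unfolding bad using \<open>finite R\<close> \<tau>r \<nu>y by (intro card_insert_disjoint) auto
  have \<tau>perm: "\<tau> permutes (R \<union> \<nu> ` R)"
    unfolding \<tau>_def using y_in \<nu>y
    by (intro permutes_compose[OF Suc.prems(1)] permutes_swap_id) auto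
  \<comment> \<open>The transposition commutes with \<open>\<nu>\<close>, as \<open>\<nu>\<close>
    swaps \<open>y\<close> and \<open>\<nu> y\<close>.\<close>
  have "\<tau> (\<nu> x) = \<nu> (\<tau> x)" for x
    using Suc.prems(2) invol by (auto simp: \<tau>_def transpose_def) (metis invol)+
  hence IH: "sign \<tau> = (-1) ^ card {s \<in> R. \<tau> s \<notin> R}"
    using Suc.hyps(2) card \<tau>perm by (intro Suc.hyps(1)) auto
  have "y \<noteq> \<nu> y" using \<nu>y r by (auto simp: y_def)
  moreover have "permutation \<sigma>"
    using Suc.prems(1) \<open>finite R\<close> by (intro permutes_imp_permutation[of "R \<union> \<nu> ` R"]) auto
  ultimately have "sign \<tau> = - sign \<sigma>"
    by (simp add: \<tau>_def sign_compose permutation_swap_id sign_swap_id)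
  with IH card show ?case by simp
qed

section \<open>A square root of -1 from Wilson's theorem\<close>

text \<open>In the factorial of \<open>p - 1 = 2 * M\<close>, the upper half consists of the factors
  \<open>p - j\<close>, congruent to \<open>-j\<close>, for \<open>j\<close> in the lower half. The
  resulting sign \<open>(-1) ^ M\<close> is 1, and Wilson's theorem evaluates the product.\<close>

lemma half_fact_square_cong:
  assumes "prime p" "p = 2 * M + 1" "even M"
  shows "[fact M ^ 2 = (-1::int)] (mod int p)"
proof -
  have img: "(\<lambda>j. int p - j) ` {1..int M} = {int M + 1..2 * int M}"
  proof (intro equalityI subsetI)
    fix x assume "x \<in> {int M + 1..2 * int M}"
    thus "x \<in> (\<lambda>j. int p - j) ` {1..int M}"
      using assms(2) by (intro image_eqI[of _ _ "int p - x"]) auto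
  qed (use assms(2) in auto)
  have fact_int: "(fact n :: int) = \<Prod>{1..int n}" for n
    by (simp add: fact_prod image_int_atLeastAtMost[of 1 n, simplified, symmetric] prod.reindex)
  have "{1..int (2 * M)} = {1..int M} \<union> {int M + 1..2 * int M}" by auto
  hence "(fact (2 * M) :: int) = \<Prod>{1..int M} * \<Prod>{int M + 1..2 * int M}"
    unfolding fact_int by (simp add: prod.union_disjoint)
  also have "\<Prod>{int M + 1..2 * int M} = (\<Prod>j\<in>{1..int M}. int p - j)"
    unfolding img[symmetric] by (subst prod.reindex) (auto simp: inj_on_def)
  finally have split: "(fact (2 * M) :: int) = \<Prod>{1..int M} * (\<Prod>j\<in>{1..int M}. int p - j)" .
  have "[(\<Prod>j\<in>{1..int M}. int p - j) = (\<Prod>j\<in>{1..int M}. (-1) * j)] (mod int p)"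
    by (intro cong_prod) (simp add: cong_iff_dvd_diff)
  also have "(\<Prod>j\<in>{1..int M}. (-1) * j) = \<Prod>{1..int M}"
    using assms(3) by (subst prod.distrib) simp
  finally have "[(fact (2 * M) :: int) = \<Prod>{1..int M} * \<Prod>{1..int M}] (mod int p)"
    unfolding split by (intro cong_mult) auto
  moreover have "[fact (2 * M) = (-1::int)] (mod int p)"
    using wilson_theorem[OF assms(1)] assms(2) by simp
  ultimately show ?thesis
    unfolding fact_int power2_eq_square by (metis cong_sym cong_trans)
qed

section \<open>The sign of the power map modulo a prime\<close>

text \<open>The identity off the residues, because \<open>permutes\<close> and \<open>sign\<close>
  concern maps on the whole type.\<close>

definition power_perm :: "nat \<Rightarrow> nat \<Rightarrow> int \<Rightarrow> int" where
  "power_perm d p = perm_restrict (\<lambda>x. x ^ d mod int p) {0..<int p}"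

lemma sign_power_perm:
  assumes "prime p" "[p = 1] (mod 4)" "[d = 3] (mod 4)"
    and perm: "power_perm d p permutes {0..<int p}"
  shows "sign (power_perm d p) = -1"
proof -
  define \<sigma> where "\<sigma> = power_perm d p"
  define m e where "m = p div 4" and "e = d div 4"
  have m: "p = 4 * m + 1" and e: "d = 4 * e + 3"
    using assms(2,3) unfolding m_def e_def cong_def by presburger+
  define M where "M = 2 * m"
  have p: "p = 2 * M + 1" and "even M" by (auto simp: M_def m)
  have "p > 2" using m prime_gt_1_nat[OF \<open>prime p\<close>] by auto
  define R where "R = {1..int M}"
  have "finite R" by (simp add: R_def)
  \<comment> \<open>Negation modulo \<open>p\<close>, extended by the identity so that it is an
    involution of all integers.\<close>
  define \<nu> where "\<nu> x = (if x \<in> {1..<int p} then int p - x else x)" for x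
  have union: "R \<union> \<nu> ` R = {1..<int p}"
  proof (intro equalityI subsetI)
    fix x assume x: "x \<in> {1..<int p}"
    show "x \<in> R \<union> \<nu> ` R"
    proof (cases "x \<in> R")
      case False
      hence "x = \<nu> (int p - x)" "int p - x \<in> R"
        using x p by (auto simp: \<nu>_def R_def)
      thus ?thesis by blast
    qed simp
  qed (use p in \<open>auto simp: R_def \<nu>_def\<close>)
  have \<nu>_perm: "permutation \<nu>"
  proof (rule permutes_imp_permutation)
    show "\<nu> permutes {1..<int p}"
    proof (rule bij_imp_permutes)
      show "bij_betw \<nu> {1..<int p} {1..<int p}"
        by (rule bij_betw_byWitness[where f' = \<nu>]) (auto simp: \<nu>_def)
    qed (auto simp: \<nu>_def)
  qed auto
  \<comment> \<open>Zero is its own negative and belongs to no half system; as \<open>d > 0\<close>,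
    it is fixed by \<open>\<sigma>\<close> and can be discarded.\<close>
  have \<sigma>0: "\<sigma> 0 = 0" using e by (simp add: \<sigma>_def power_perm_def perm_restrict_def power_0_left)
  have \<sigma>_perm: "\<sigma> permutes {1..<int p}"
  proof (rule permutes_superset)
    show "\<sigma> permutes {0..<int p}" using perm by (simp add: \<sigma>_def)
    fix x assume "x \<in> {0..<int p} - {1..<int p}"
    hence "x = 0" by auto
    thus "\<sigma> x = x" using \<sigma>0 by simp
  qed
  have \<sigma>_in: "\<sigma> x \<in> {1..<int p} \<longleftrightarrow> x \<in> {1..<int p}" for x
    by (rule permutes_in_image[OF \<sigma>_perm])
  have \<sigma>_cong: "[\<sigma> x = x ^ d] (mod int p)" if "x \<in> {1..<int p}" for x
    using that by (simp add: \<sigma>_def power_perm_def perm_restrict_def)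
  have \<nu>_cong: "[\<nu> x = - x] (mod int p)" if "x \<in> {1..<int p}" for x
    using that by (simp add: \<nu>_def cong_iff_dvd_diff)
  have "odd d" using e by simp
  have comm: "\<sigma> (\<nu> x) = \<nu> (\<sigma> x)" for x
  proof (cases "x \<in> {1..<int p}")
    case True
    have \<nu>_in: "\<nu> y \<in> {1..<int p}" if "y \<in> {1..<int p}" for y
      using that by (auto simp: \<nu>_def)
    have "[\<sigma> (\<nu> x) = \<nu> x ^ d] (mod int p)" using \<sigma>_cong \<nu>_in True by blast
    also have "[\<nu> x ^ d = (- x) ^ d] (mod int p)" using \<nu>_cong True by (intro cong_pow) auto
    also have "(- x) ^ d = - (x ^ d)" using \<open>odd d\<close> by simp
    also have "[- (x ^ d) = - \<sigma> x] (mod int p)"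
      using \<sigma>_cong[OF True] by (simp add: cong_minus_minus_iff cong_sym_eq)
    also have "[- \<sigma> x = \<nu> (\<sigma> x)] (mod int p)" using \<nu>_cong[of "\<sigma> x"] \<sigma>_in True by (simp add: cong_sym_eq)
    finally have "[\<sigma> (\<nu> x) = \<nu> (\<sigma> x)] (mod int p)" .
    moreover have "\<sigma> (\<nu> x) \<in> {1..<int p}" "\<nu> (\<sigma> x) \<in> {1..<int p}"
      using \<nu>_in \<sigma>_in True by blast+
    ultimately show ?thesis by (intro cong_less_imp_eq_int) auto
  next
    case False
    hence "\<nu> x = x" "\<sigma> x = x" using permutes_not_in[OF \<sigma>_perm] by (auto simp: \<nu>_def)
    thus ?thesis by simp
  qed
  have \<nu>\<nu>: "\<nu> (\<nu> x) = x" for x by (auto simp: \<nu>_def)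
  have disj: "R \<inter> \<nu> ` R = {}" using p by (auto simp: R_def \<nu>_def)
  define k where "k = card {r \<in> R. \<sigma> r \<notin> R}"
  have sign: "sign \<sigma> = (-1) ^ k"
    unfolding k_def
  proof (rule sign_commuting_involution[where \<nu> = \<nu>])
    show "\<sigma> permutes R \<union> \<nu> ` R" using \<sigma>_perm by (simp only: union)
  qed (fact \<open>finite R\<close> \<nu>\<nu> \<nu>_perm disj comm)+

  \<comment> \<open>The representative in \<open>R\<close> of \<open>\<sigma> x\<close> up to sign,
    as in Gauss's lemma.\<close>
  define \<phi> where "\<phi> x = (if \<sigma> x \<in> R then \<sigma> x else \<nu> (\<sigma> x))" for x
  have R_sub: "R \<subseteq> {1..<int p}" using union by blast
  have \<phi>_in: "\<phi> x \<in> R" if "x \<in> R" for x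
  proof -
    have "\<sigma> x \<in> R \<union> \<nu> ` R" using that \<sigma>_in union by blast
    thus ?thesis using \<nu>\<nu> by (auto simp: \<phi>_def)
  qed
  have inj: "inj_on \<phi> R"
  proof (rule inj_onI)
    fix x y assume xy: "x \<in> R" "y \<in> R" "\<phi> x = \<phi> y"
    \<comment> \<open>Equal representatives mean equality up to sign, and \<open>\<sigma>\<close>
      respects signs.\<close>
    have "\<sigma> x = \<sigma> y \<or> \<sigma> x = \<sigma> (\<nu> y)"
      using xy(3) \<nu>\<nu> comm unfolding \<phi>_def by (metis (full_types))
    hence "x = y \<or> x = \<nu> y"
      using permutes_inj[OF \<sigma>_perm] by (auto dest: injD)
    thus "x = y" using xy disj by blast
  qed
  have "\<phi> ` R = R"
    using \<phi>_in \<open>finite R\<close> inj by (intro endo_inj_surj) auto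
  hence prod_\<phi>: "prod \<phi> R = \<Prod>R"
    using prod.reindex[OF inj, of "\<lambda>x. x"] by simp
  have "[(\<Prod>x\<in>R. x ^ d) = (\<Prod>x\<in>R. (if \<sigma> x \<in> R then 1 else - 1) * \<phi> x)] (mod int p)"
  proof (intro cong_prod)
    fix x assume "x \<in> R"
    hence x: "x \<in> {1..<int p}" using R_sub by blast
    have "[\<sigma> x = (if \<sigma> x \<in> R then 1 else - 1) * \<phi> x] (mod int p)"
      using \<nu>_cong[of "\<sigma> x"] \<sigma>_in[of x] x
      by (auto simp: \<phi>_def cong_iff_dvd_diff algebra_simps)
    thus "[x ^ d = (if \<sigma> x \<in> R then 1 else - 1) * \<phi> x] (mod int p)"
      using \<sigma>_cong[OF x] by (metis cong_sym cong_trans)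
  qed
  \<comment> \<open>The factor -1 occurs \<open>k\<close> times, and \<open>\<phi>\<close> only
    permutes \<open>R\<close>.\<close>
  also have "(\<Prod>x\<in>R. (if \<sigma> x \<in> R then 1 else - 1) * \<phi> x) = (-1) ^ k * \<Prod>R"
    using \<open>finite R\<close> by (simp add: prod.distrib prod_\<phi> prod.If_cases k_def Int_def)
  finally have "[(\<Prod>R) ^ d = (-1) ^ k * \<Prod>R] (mod int p)"
    by (simp add: prod_power_distrib)
  moreover have R_fact: "\<Prod>R = fact M"
    by (simp add: R_def fact_prod image_int_atLeastAtMost[of 1 M, simplified, symmetric] prod.reindex)
  ultimately have "[fact M ^ (d - 1) * fact M = (-1) ^ k * (fact M :: int)] (mod int p)"
    using power_minus_mult[OF odd_pos[OF \<open>odd d\<close>], of "fact M :: int"] by simp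
  moreover have "coprime (fact M :: int) (int p)"
  proof -
    have "\<not> p dvd fact M" using \<open>prime p\<close> p by (simp add: prime_dvd_fact_iff)
    hence "coprime (fact M) p"
      using \<open>prime p\<close> by (simp add: prime_imp_coprime coprime_commute)
    thus ?thesis by (metis coprime_int_iff of_nat_fact)
  qed
  ultimately have "[fact M ^ (d - 1) = (-1::int) ^ k] (mod int p)"
    using cong_mult_rcancel by blast
  moreover have "[(fact M ^ 2) ^ (2 * e + 1) = (-1::int) ^ (2 * e + 1)] (mod int p)"
    using half_fact_square_cong[OF \<open>prime p\<close> p \<open>even M\<close>] by (rule cong_pow)
  moreover have "(fact M ^ 2) ^ (2 * e + 1) = (fact M :: int) ^ (d - 1)"
  proof -
    \<comment> \<open>The odd cofactor \<open>2 * e + 1\<close> is what \<open>d = 3\<close> modulo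
      4 provides; it preserves the sign of -1.\<close>
    have "d - 1 = 2 * (2 * e + 1)" using e by simp
    thus ?thesis by (metis power_mult)
  qed
  ultimately have "[(-1) ^ k = (-1::int) ^ (2 * e + 1)] (mod int p)"
    by (metis cong_sym cong_trans)
  hence "[(-1) ^ k = (-1::int)] (mod int p)" by simp
  moreover have "\<not> [1 = (-1::int)] (mod int p)"
    using \<open>p > 2\<close> by (auto simp: cong_iff_dvd_diff dest: zdvd_imp_le)
  ultimately have "odd k" by (cases "even k") auto
  thus ?thesis using sign by (simp add: \<sigma>_def)
qed

section \<open>Translations modulo \<open>p\<close>, and the contradiction of signs\<close>

definition shift_perm :: "int \<Rightarrow> nat \<Rightarrow> int \<Rightarrow> int" where
  "shift_perm c p = perm_restrict (\<lambda>x. (x + c) mod int p) {0..<int p}"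

lemma shift_perm_permutes:
  assumes "p > 0"
  shows "shift_perm c p permutes {0..<int p}"
proof (rule bij_imp_permutes)
  show "bij_betw (shift_perm c p) {0..<int p} {0..<int p}"
    using assms
    by (intro bij_betw_byWitness[where f' = "shift_perm (- c) p"])
      (auto simp: shift_perm_def perm_restrict_def mod_simps)
qed (auto simp: shift_perm_def perm_restrict_def)

text \<open>Translating \<open>p\<close> times adds \<open>p * c\<close>, which vanishes modulo
  \<open>p\<close>.\<close>

lemma shift_perm_funpow:
  assumes "p > 0"
  shows "shift_perm c p ^^ p = id"
proof
  fix x
  show "(shift_perm c p ^^ p) x = id x"
  proof (cases "x \<in> {0..<int p}")
    case True
    have "(shift_perm c p ^^ n) x = (x + int n * c) mod int p" for n
      using True assms
      by (induction n) (auto simp: shift_perm_def perm_restrict_def mod_simps algebra_simps)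
    from this[of p] True show ?thesis by simp
  next
    case False
    hence "(shift_perm c p ^^ n) x = x" for n
      by (induction n) (auto simp: shift_perm_def perm_restrict_def)
    thus ?thesis by simp
  qed
qed

theorem theorem1p3:
  fixes c :: int and d p :: nat
  assumes "d \<ge> 2"
    and "[d = 3] (mod 4)"
    and "prime p"
    and "[p = 1] (mod 4)"
  shows "p \<notin> single_cycle_primes d c"
proof
  assume "p \<in> single_cycle_primes d c"
  hence cyc: "single_cycle_mod (unicritical_poly d c) p"
    by (simp add: single_cycle_primes_def)
  define S where "S = {0..<int p}"
  define f where "f = perm_restrict (induced_map (unicritical_poly d c) p) S"
  have "p > 0" using \<open>prime p\<close> by (rule prime_gt_0_nat)
  have "odd p" using \<open>[p = 1] (mod 4)\<close> by (auto simp: cong_def) presburger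
  have carrier: "carrier (residue_ring (int p)) = S"
    by (auto simp: residue_ring_def S_def)
  have f_bij: "bij_betw f S S"
    using cyc unfolding single_cycle_mod_def carrier
    by (auto simp: f_def perm_restrict_def cong: bij_betw_cong)
  hence f_perm: "f permutes S"
    by (rule bij_imp_permutes) (simp add: f_def perm_restrict_def)
  have "cyclic_on f S"
    using cyc by (simp add: single_cycle_mod_def carrier f_def cyclic_on_perm_restrict)
  from funpow_card_cyclic_on[OF f_perm this] have "f ^^ p = id"
    by (simp add: S_def)
  have permutationI: "permutation g" if "g permutes S" for g
    using that by (rule permutes_imp_permutation[rotated]) (simp add: S_def)
  have sign_f: "sign f = 1"
    using permutationI[OF f_perm] \<open>f ^^ p = id\<close> \<open>odd p\<close> by (rule sign_eq_1_if_odd_funpow_eq_id)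
  have t_perm: "shift_perm c p permutes S"
    unfolding S_def using \<open>p > 0\<close> by (rule shift_perm_permutes)
  have sign_t: "sign (shift_perm c p) = 1"
    using permutationI[OF t_perm] shift_perm_funpow[OF \<open>p > 0\<close>] \<open>odd p\<close>
    by (rule sign_eq_1_if_odd_funpow_eq_id)
  have "f = shift_perm c p \<circ> power_perm d p"
    using \<open>p > 0\<close>
    by (auto simp: f_def shift_perm_def power_perm_def perm_restrict_def S_def
        induced_map_def poly_unicritical_poly mod_simps)
  \<comment> \<open>Undoing the translation shows at once that the power map is a permutation and
    that it is even.\<close>
  hence "power_perm d p = inv_into UNIV (shift_perm c p) \<circ> f"
    by (simp add: permutes_inv_o[OF t_perm] comp_assoc[symmetric])
  moreover have "inv_into UNIV (shift_perm c p) \<circ> f permutes S"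
    by (intro permutes_compose f_perm permutes_inv t_perm)
  ultimately have "sign (power_perm d p) = 1" "power_perm d p permutes {0..<int p}"
    using sign_f sign_t permutationI[OF f_perm] permutationI[OF t_perm]
    by (simp_all add: sign_compose sign_inverse permutation_inverse S_def)
  with sign_power_perm[OF \<open>prime p\<close> assms(4) assms(2)] show False by simp
qed

end
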